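(* Let $L$ be an odd unimodular lattice of rank $n$ with $n\equiv 5\pmod 8$, having no vector of norm $1$, and such that $\mathrm{Exc}\,L\neq\emptyset$. Then $|\mathrm{Exc}\,L|=2m$ for some integer $1\le m\le n$, and $\mathrm{W}(L)^{\pm}$ acts transitively on $\mathrm{Exc}\,L$.
   Context: A lattice is an integral Euclidean lattice (positive definite $\mathbb{Z}$-valued symmetric bilinear form $x\cdot y$); it is odd if some vector has odd norm, unimodular if it equals its dual. A characteristic vector of $L$ is $\xi\in L$ with $x\cdot\xi\equiv x\cdot x\pmod 2$ for all $x\in L$; $\mathrm{Exc}\,L$ is the set of characteristic vectors of norm $<8$. $\mathrm{W}(L)$ is the group generated by the reflections $s_\alpha(x)=x-(x\cdot\alpha)\alpha$ for $\alpha\in L$ of norm $2$, and $\mathrm{W}(L)^{\pm}$ is generated by $\mathrm{W}(L)$ and $-\mathrm{id}$. *)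

theory Defs
  imports "HOL-Analysis.Analysis" "HOL-Algebra.Generated_Groups" "HOL-Algebra.Group_Action"
    "HOL-Library.Real_Mod"
begin

text \<open>
  Lattices live in an ambient Euclidean space, which they need not span, and the bilinear form is
  the inner product \<open>x \<bullet> y\<close>. The lattice-theoretic "norm" of \<open>x\<close> is \<open>x \<bullet> x\<close>, that is, the
  square of \<open>norm x\<close>.
\<close>

definition lattice_basis :: "'a::euclidean_space set \<Rightarrow> 'a set \<Rightarrow> bool" where
  "lattice_basis B L \<longleftrightarrow>
     finite B \<and> independent B \<and> L = range (\<lambda>c :: 'a \<Rightarrow> int. \<Sum>b\<in>B. of_int (c b) *\<^sub>R b)"

definition integral_lattice_of_rank :: "nat \<Rightarrow> 'a::euclidean_space set \<Rightarrow> bool" where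
  "integral_lattice_of_rank n L \<longleftrightarrow>
     (\<exists>B. lattice_basis B L \<and> card B = n) \<and> (\<forall>x\<in>L. \<forall>y\<in>L. x \<bullet> y \<in> \<int>)"

definition dual_lattice :: "'a::euclidean_space set \<Rightarrow> 'a set" where
  "dual_lattice L = {v \<in> span L. \<forall>x\<in>L. v \<bullet> x \<in> \<int>}"

definition unimodular :: "'a::euclidean_space set \<Rightarrow> bool" where
  "unimodular L \<longleftrightarrow> dual_lattice L = L"

definition odd_lattice :: "'a::euclidean_space set \<Rightarrow> bool" where
  "odd_lattice L \<longleftrightarrow> (\<exists>x\<in>L. [x \<bullet> x = 1] (rmod 2))"

definition characteristic_vectors :: "'a::euclidean_space set \<Rightarrow> 'a set" where
  "characteristic_vectors L = {\<xi> \<in> L. \<forall>x\<in>L. [x \<bullet> \<xi> = x \<bullet> x] (rmod 2)}"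

definition Exc :: "'a::euclidean_space set \<Rightarrow> 'a set" where
  "Exc L = {\<xi> \<in> characteristic_vectors L. \<xi> \<bullet> \<xi> < 8}"

text \<open>
  The groups below consist of permutations of \<open>L\<close>. Elements of \<^term>\<open>BijGroup L\<close> are extensional,
  which is why the generators are restricted to \<open>L\<close>.
\<close>

definition root_reflection :: "'a::euclidean_space set \<Rightarrow> 'a \<Rightarrow> 'a \<Rightarrow> 'a" where
  "root_reflection L \<alpha> = (\<lambda>x\<in>L. x - (x \<bullet> \<alpha>) *\<^sub>R \<alpha>)"

definition weyl_group :: "'a::euclidean_space set \<Rightarrow> ('a \<Rightarrow> 'a) set" where
  "weyl_group L = generate (BijGroup L) {root_reflection L \<alpha> | \<alpha>. \<alpha> \<in> L \<and> \<alpha> \<bullet> \<alpha> = 2}"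

definition weyl_group_pm :: "'a::euclidean_space set \<Rightarrow> ('a \<Rightarrow> 'a) set" where
  "weyl_group_pm L = generate (BijGroup L) (insert (\<lambda>x\<in>L. - x) (weyl_group L))"

end

theory Submission
  imports Defs "HOL-Number_Theory.Cong" "Jordan_Normal_Form.Determinant"
begin

text \<open>
  The norm of a characteristic vector of a unimodular lattice of rank \<open>n\<close> is congruent to \<open>n\<close> modulo 4.
  This weak form of van der Blij's theorem follows from the fact that an even symmetric integer matrix
  has even determinant in odd size, and determinant \<open>0\<close> or \<open>(-1)\<^sup>k\<close> modulo 4 in size \<open>2k\<close>. Hence
  exceptional vectors have norm 1 or 5, so 5 in the absence of vectors of norm 1.

  For exceptional \<open>\<xi>\<close> and \<open>\<eta>\<close> the vectors \<open>(\<xi> - \<eta>)/2\<close> and \<open>(\<xi> + \<eta>)/2\<close> lie in \<open>L\<close> and do not have norm 1,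
  so \<open>\<xi> \<bullet> \<eta>\<close> is \<open>1\<close> or \<open>-1\<close> unless \<open>\<eta> = \<xi>\<close> or \<open>\<eta> = - \<xi>\<close>. If \<open>\<xi> \<bullet> \<eta> = 1\<close>, then \<open>(\<xi> - \<eta>)/2\<close> is a root whose
  reflection maps \<open>\<xi>\<close> to \<open>\<eta>\<close>, which gives transitivity. The roots \<open>(\<xi> - \<eta>)/2\<close> and \<open>(\<xi> - \<zeta>)/2\<close> have integral
  inner product \<open>(3 + \<eta> \<bullet> \<zeta>)/4\<close>, so the exceptional vectors on the positive side of \<open>\<xi>\<close> have pairwise inner
  product 1. They are therefore linearly independent, and there are at most \<open>n\<close> of them.
\<close>

hide_const (open) Determinants.det Matrix.orthogonal
no_notation scalar_prod (infix \<open>\<bullet>\<close> 70)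

section \<open>Determinants of even symmetric integer matrices\<close>

text \<open>The rows and the columns each contribute the sign of \<open>p\<close>, and the two signs
  cancel.\<close>

lemma simultaneous_permutation_det:
  fixes W :: "'a::comm_ring_1 mat"
  assumes W: "W \<in> carrier_mat n n" and p: "p permutes {0..<n}"
  shows "det (mat n n (\<lambda>(i,j). W $$ (p i, p j))) = det W"
proof -
  let ?R = "mat n n (\<lambda>(i,j). W $$ (p i, j))"
  have less: "p i < n" if "i < n" for i
    using permutes_in_image[OF p, of i] that by simp
  have R: "?R \<in> carrier_mat n n" by simp
  have "det (mat n n (\<lambda>(i,j). W $$ (p i, p j))) = det (mat n n (\<lambda>(i,j). ?R\<^sup>T $$ (p i, j)))\<^sup>T"
    by (rule arg_cong[of _ _ det], rule eq_matI) (auto simp: less)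
  also have "\<dots> = det (mat n n (\<lambda>(i,j). ?R\<^sup>T $$ (p i, j)))"
    by (rule det_transpose[where n = n]) simp
  also have "\<dots> = signof p * det ?R\<^sup>T"
    by (rule det_permute_rows[where n = n, OF _ p]) simp
  also have "det ?R\<^sup>T = signof p * det W"
    using det_transpose[OF R] det_permute_rows[OF W p] by simp
  finally show ?thesis
    by (simp add: sign_def)
qed

text \<open>Serves to bring an odd off-diagonal entry into the leading 2x2 block, where it acts as
  the pivot.\<close>

lemma ex_permutes_first_two:
  assumes "i < n" "j < n" "i \<noteq> j"
  shows "\<exists>p. p permutes {0..<n} \<and> p 0 = i \<and> p (Suc 0) = j"
proof -
  \<comment> \<open>The transposition of \<open>i\<close> and \<open>0\<close> sends
    \<open>k\<close> back to \<open>j\<close>. As \<open>j\<close> differs from \<open>i\<close>,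
    \<open>k\<close> is not \<open>0\<close>, so swapping \<open>1\<close> with \<open>k\<close>
    first leaves \<open>0\<close> in place.\<close>
  define k where "k = Transposition.transpose i 0 j"
  have k: "k \<noteq> 0" "k < n" "Transposition.transpose i 0 k = j"
    using assms by (auto simp: k_def Transposition.transpose_def split: if_splits)
  have n: "0 < n" "Suc 0 < n" using assms by auto
  have "Transposition.transpose i 0 \<circ> Transposition.transpose (Suc 0) k permutes {0..<n}"
    by (intro permutes_compose permutes_swap_id) (use assms k n in auto)
  moreover have "(Transposition.transpose i 0 \<circ> Transposition.transpose (Suc 0) k) 0 = i"
    using k by (simp add: Transposition.transpose_def)
  moreover have "(Transposition.transpose i 0 \<circ> Transposition.transpose (Suc 0) k) (Suc 0) = j"
    using k by simp
  ultimately show ?thesis by blast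
qed

lemma det_mat_2:
  fixes A :: "'a::comm_ring_1 mat"
  assumes "A \<in> carrier_mat 2 2"
  shows "det A = A $$ (0,0) * A $$ (1,1) - A $$ (0,1) * A $$ (1,0)"
proof -
  have 2: "{..<2::nat} = {0, 1}" by auto
  have "det A = (\<Sum>i<2. A $$ (i,0) * cofactor A i 0)"
    by (rule laplace_expansion_column[OF assms]) simp
  also have "\<dots> = A $$ (0,0) * A $$ (1,1) - A $$ (1,0) * A $$ (0,1)"
    using assms by (simp add: 2 cofactor_def mat_delete_def det_single)
  finally show ?thesis by simp
qed

text \<open>
  The matrix \<open>S\<close> is the Schur complement of the leading block \<open>[[x, a], [a, y]]\<close>, multiplied by the
  determinant \<open>d\<close> of that block so that no division occurs.
\<close>
lemma det_eliminate_2x2: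
  fixes W :: "'a::idom mat"
  assumes W: "W \<in> carrier_mat (2 + m) (2 + m)"
    and sym: "\<And>i j. i < 2 + m \<Longrightarrow> j < 2 + m \<Longrightarrow> W $$ (i,j) = W $$ (j,i)"
    and x: "x = W $$ (0,0)" and a: "a = W $$ (0,1)" and y: "y = W $$ (1,1)"
    and d: "d = x * y - a * a"
    and S: "S = mat m m (\<lambda>(i,j). d * W $$ (i + 2, j + 2)
        - (y * W $$ (i + 2, 0) * W $$ (j + 2, 0)
          - a * (W $$ (i + 2, 0) * W $$ (j + 2, 1) + W $$ (i + 2, 1) * W $$ (j + 2, 0))
          + x * W $$ (i + 2, 1) * W $$ (j + 2, 1)))"
  shows "d ^ m * det W = d * det S"
proof -
  define H where "H = mat 2 2 (\<lambda>(i,j). W $$ (i,j))"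
  define B where "B = mat 2 m (\<lambda>(i,j). W $$ (i, j + 2))"
  define C where "C = mat m 2 (\<lambda>(i,j). W $$ (i + 2, j))"
  define D where "D = mat m m (\<lambda>(i,j). W $$ (i + 2, j + 2))"
  \<comment> \<open>\<open>X\<close> is minus \<open>C\<close> times the adjugate of
    \<open>H\<close>, so \<open>X * H\<close> is \<open>- d\<close> times \<open>C\<close>.\<close>
  define X where "X = mat m 2 (\<lambda>(i,j). if j = 0 then a * W $$ (i + 2, 1) - y * W $$ (i + 2, 0)
    else a * W $$ (i + 2, 0) - x * W $$ (i + 2, 1))"
  have car: "H \<in> carrier_mat 2 2" "B \<in> carrier_mat 2 m" "C \<in> carrier_mat m 2" "D \<in> carrier_mat m m"
    "X \<in> carrier_mat m 2" "S \<in> carrier_mat m m"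
    by (simp_all add: H_def B_def C_def D_def X_def S)
  have two: "{0..<2::nat} = {0, 1}" by auto
  have shift: "Suc (Suc (i - 2)) = i" if "\<not> i < 2" for i
    using that by simp
  have Wb: "W = four_block_mat H B C D"
    by (rule eq_matI) (use W in \<open>auto simp: H_def B_def C_def D_def shift\<close>)
  have ent: "W $$ (0,0) = x" "W $$ (0,Suc 0) = a" "W $$ (Suc 0,0) = a" "W $$ (Suc 0,Suc 0) = y"
    using sym[of 1 0] x a y by simp_all
  have detH: "det H = d"
    using det_mat_2[OF car(1)] by (simp add: H_def d ent)
  have lower: "X * H + (d \<cdot>\<^sub>m 1\<^sub>m m) * C = 0\<^sub>m m 2"
  proof (rule eq_matI)
    fix i j assume "i < dim_row (0\<^sub>m m 2)" "j < dim_col (0\<^sub>m m 2)"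
    then have ij: "i < m" "j = 0 \<or> j = 1" using less_2_cases[of j] by auto
    have dC: "(d \<cdot>\<^sub>m 1\<^sub>m m) * C = d \<cdot>\<^sub>m C"
      using car(3) mult_smult_assoc_mat[of "1\<^sub>m m" m m C 2 d] by simp
    show "(X * H + (d \<cdot>\<^sub>m 1\<^sub>m m) * C) $$ (i, j) = 0\<^sub>m m 2 $$ (i, j)"
      unfolding dC using ij(2)
      by (elim disjE) (use ij(1) in \<open>simp_all add: X_def H_def C_def scalar_prod_def two d ent algebra_simps\<close>)
  qed (use car in auto)
  have right: "X * B + (d \<cdot>\<^sub>m 1\<^sub>m m) * D = S"
  proof (rule eq_matI)
    fix i j assume "i < dim_row S" "j < dim_col S"
    then have ij: "i < m" "j < m" by (auto simp: S)
    have dD: "(d \<cdot>\<^sub>m 1\<^sub>m m) * D = d \<cdot>\<^sub>m D"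
      using car(4) mult_smult_assoc_mat[of "1\<^sub>m m" m m D m d] by simp
    show "(X * B + (d \<cdot>\<^sub>m 1\<^sub>m m) * D) $$ (i, j) = S $$ (i, j)"
      unfolding dD using ij sym[of "j + 2" 0] sym[of "j + 2" 1]
      by (simp add: X_def B_def D_def S scalar_prod_def two algebra_simps)
  qed (use car in auto)
  \<comment> \<open>A block row operation: \<open>?P\<close> is block lower triangular with
    determinant \<open>d ^ m\<close> and clears the lower left block of \<open>W\<close>.\<close>
  let ?P = "four_block_mat (1\<^sub>m 2) (0\<^sub>m 2 m) X (d \<cdot>\<^sub>m 1\<^sub>m m)"
  have "?P * W = four_block_mat H B (0\<^sub>m m 2) S"
    unfolding Wb
    by (subst mult_four_block_mat[of _ 2 2 _ m _ m _ _ 2 _ m]) (use car lower right in auto)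
  then have "det ?P * det W = det (four_block_mat H B (0\<^sub>m m 2) S)"
    using det_mult[of ?P "2 + m" W] W by (metis four_block_carrier_mat one_carrier_mat smult_carrier_mat)
  moreover have "det (four_block_mat H B (0\<^sub>m m 2) S) = d * det S"
    using det_four_block_mat_lower_left_zero[OF car(1,2) refl car(6)] detH by simp
  moreover have "det ?P = d ^ m"
    by (subst det_four_block_mat_upper_right_zero[of _ 2 _ m]) (use car in auto)
  ultimately show ?thesis by simp
qed

text \<open>
  Pivoting on an odd off-diagonal entry \<open>a\<close> gives \<open>d = x * y - a\<^sup>2\<close> congruent to \<open>-1\<close> modulo 4, and the
  scaled Schur complement again has even diagonal.
\<close>
lemma even_symmetric_det:
  fixes W :: "int mat"
  assumes "W \<in> carrier_mat n n"
    and "\<And>i j. i < n \<Longrightarrow> j < n \<Longrightarrow> W $$ (i,j) = W $$ (j,i)"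
    and "\<And>i. i < n \<Longrightarrow> even (W $$ (i,i))"
  shows "(odd n \<longrightarrow> even (det W)) \<and> (even n \<longrightarrow> 4 dvd det W \<or> 4 dvd det W - (-1) ^ (n div 2))"
  using assms
proof (induction n arbitrary: W rule: less_induct)
  case (less n)
  note W = less.prems(1) and sym = less.prems(2) and diag = less.prems(3)
  show ?case
  proof (cases "\<forall>i<n. \<forall>j<n. even (W $$ (i,j))")
    case True
    define V where "V = mat n n (\<lambda>(i,j). W $$ (i,j) div 2)"
    have V: "V \<in> carrier_mat n n" by (simp add: V_def)
    have "W = 2 \<cdot>\<^sub>m V"
      by (rule eq_matI) (use W True in \<open>auto simp: V_def\<close>)
    then have "det W = det (2 \<cdot>\<^sub>m V)" by (rule arg_cong)
    then have det: "det W = 2 ^ n * det V" using V by simp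
    show ?thesis
    \<comment> \<open>The factor \<open>2 ^ n\<close> settles all sizes but the empty one, whose
      determinant 1 is the value \<open>(-1) ^ 0\<close>.\<close>
    proof (cases "n = 0")
      case True
      with W show ?thesis by simp
    next
      case False
      have "(2::int) ^ 2 dvd 2 ^ n" if "even n"
        by (rule le_imp_power_dvd) (use that False in presburger)
      then have "4 dvd det W" if "even n"
        using that det by (simp add: dvd_mult2)
      with det False show ?thesis by auto
    qed
  next
    case False
    then obtain i j where ij: "i < n" "j < n" "odd (W $$ (i,j))" by auto
    then have "i \<noteq> j" using diag by auto
    then obtain p where p: "p permutes {0..<n}" "p 0 = i" "p (Suc 0) = j"
      using ex_permutes_first_two ij by blast
    define m where "m = n - 2"
    have n: "n = 2 + m" using ij(1,2) \<open>i \<noteq> j\<close> by (auto simp: m_def)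
    define V where "V = mat n n (\<lambda>(i,j). W $$ (p i, p j))"
    have less: "p i < n" if "i < n" for i
      using permutes_in_image[OF p(1), of i] that by simp
    have V: "V \<in> carrier_mat n n" by (simp add: V_def)
    have detV: "det V = det W"
      unfolding V_def by (rule simultaneous_permutation_det[OF W p(1)])
    have symV: "V $$ (i,j) = V $$ (j,i)" if "i < n" "j < n" for i j
      using that sym less by (simp add: V_def)
    have diagV: "even (V $$ (i,i))" if "i < n" for i
      using that diag less by (simp add: V_def)
    define x where "x = V $$ (0,0)"
    define a where "a = V $$ (0,1)"
    define y where "y = V $$ (1,1)"
    define d where "d = x * y - a * a"
    define S where "S = mat m m (\<lambda>(i,j). d * V $$ (i + 2, j + 2)
        - (y * V $$ (i + 2, 0) * V $$ (j + 2, 0)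
          - a * (V $$ (i + 2, 0) * V $$ (j + 2, 1) + V $$ (i + 2, 1) * V $$ (j + 2, 0))
          + x * V $$ (i + 2, 1) * V $$ (j + 2, 1)))"
    have parity: "even x" "even y" "odd a"
      using diagV[of 0] diagV[of 1] ij(3) p n by (auto simp: x_def y_def a_def V_def)
    have d4: "4 dvd d + 1"
    proof -
      obtain x' y' a' where "x = 2 * x'" "y = 2 * y'" "a = 2 * a' + 1"
        using parity by (meson evenE oddE)
      then have "d + 1 = 4 * (x' * y' - a' * a' - a')"
        by (simp add: d_def algebra_simps)
      then show ?thesis by simp
    qed
    have red: "d ^ m * det W = d * det S"
      using det_eliminate_2x2[of V m x a y d S] V symV n detV
      by (simp add: x_def a_def y_def d_def S_def)
    have IH: "(odd m \<longrightarrow> even (det S)) \<and> (even m \<longrightarrow> 4 dvd det S \<or> 4 dvd det S - (-1) ^ (m div 2))"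
    proof (rule less.IH)
      show "m < n" using n by simp
      show "S \<in> carrier_mat m m" by (simp add: S_def)
      show "S $$ (i,j) = S $$ (j,i)" if "i < m" "j < m" for i j
        using that symV[of "i+2" "j+2"] n by (simp add: S_def algebra_simps)
      show "even (S $$ (i,i))" if "i < m" for i
        using that diagV[of "i+2"] parity n by (simp add: S_def)
    qed
    have dodd: "odd d" using d4 by presburger
    show ?thesis
    proof (cases "even m")
      case False
      then have "even (det S)" using IH by blast
      then have "even (d ^ m * det W)" using red by simp
      with dodd False n show ?thesis by simp
    next
      case True
      then obtain k where k: "m = 2 * k" by blast
      \<comment> \<open>As \<open>m\<close> is even, \<open>d ^ m\<close> is 1 modulo 4, so
        \<open>det W\<close> is \<open>- det S\<close>: enlarging the size by 2 flips the sign, in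
        step with \<open>(-1) ^ (n div 2)\<close>.\<close>
      have "[d = -1] (mod 4)"
        using d4 by (simp add: cong_iff_dvd_diff)
      then have "[d ^ m * det W = (-1) ^ m * det W] (mod 4)" "[d * det S = -1 * det S] (mod 4)"
        by (intro cong_mult cong_pow cong_refl; assumption)+
      then have "[det W = - det S] (mod 4)"
        using red True by (simp add: cong_def)
      then have "4 dvd det W + det S" by (simp add: cong_iff_dvd_diff)
      moreover have "4 dvd det S \<or> 4 dvd det S - (-1) ^ k" using IH True k by simp
      ultimately have "4 dvd det W \<or> 4 dvd det W + (-1) ^ k" by (smt (verit) dvd_diff dvd_add_left_iff)
      then show ?thesis using n k by simp
    qed
  qed
qed

section \<open>Bordered matrices and norms of characteristic vectors modulo 4\<close>

text \<open>Since \<open>w = A * c\<close>, the symmetric border of \<open>A\<close> by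
  \<open>- w\<close> and \<open>s\<close> factors as \<open>?F * ?G\<close> with determinant
  \<open>det A * (s - q)\<close>; here \<open>c\<close> stands in for the inverse of
  \<open>A\<close> applied to \<open>w\<close>. A unipotent column operation then puts
  \<open>A - w w\<^sup>T\<close> in the corner. The lower left block vanishes for
  \<open>s = 1\<close> and is \<open>- w\<^sup>T\<close> for \<open>s = 0\<close>, the two cases
  used.\<close>

lemma det_bordered:
  fixes A c :: "'a::idom mat"
  assumes A: "A \<in> carrier_mat n n" and c: "c \<in> carrier_mat n 1"
    and w: "w = A * c" and q: "q = (\<Sum>i<n. w $$ (i,0) * c $$ (i,0))"
  shows "det (four_block_mat (mat n n (\<lambda>(i,j). A $$ (i,j) - w $$ (i,0) * w $$ (j,0))) (- w)
      ((s - 1) \<cdot>\<^sub>m w\<^sup>T) (mat 1 1 (\<lambda>_. s))) = det A * (s - q)"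
proof -
  let ?M = "mat n n (\<lambda>(i,j). A $$ (i,j) - w $$ (i,0) * w $$ (j,0))"
  let ?s = "mat 1 1 (\<lambda>_. s)"
  let ?t = "mat 1 1 (\<lambda>_. s - q)"
  let ?F = "four_block_mat A (0\<^sub>m n 1) (- w\<^sup>T) (1\<^sub>m 1)"
  let ?G = "four_block_mat (1\<^sub>m n) (- c) (0\<^sub>m 1 n) ?t"
  let ?H = "four_block_mat (1\<^sub>m n) (0\<^sub>m n 1) (w\<^sup>T) (1\<^sub>m 1)"
  let ?K = "four_block_mat A (- w) (- w\<^sup>T) ?s"
  let ?N = "four_block_mat ?M (- w) ((s - 1) \<cdot>\<^sub>m w\<^sup>T) ?s"
  have wc: "w \<in> carrier_mat n 1" using A c w by simp
  have FG: "?F * ?G = ?K"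
  proof (subst mult_four_block_mat[of _ n n _ 1 _ 1 _ _ n _ 1])
    have "A * (- c) + 0\<^sub>m n 1 * ?t = - w"
      by (rule eq_matI) (use A c w in auto)
    moreover have "- w\<^sup>T * (- c) + 1\<^sub>m 1 * ?t = ?s"
      by (rule eq_matI) (use wc c q in \<open>auto simp: scalar_prod_def lessThan_atLeast0\<close>)
    moreover have "A * 1\<^sub>m n + 0\<^sub>m n 1 * 0\<^sub>m 1 n = A" "- w\<^sup>T * 1\<^sub>m n + 1\<^sub>m 1 * 0\<^sub>m 1 n = - w\<^sup>T"
      using A wc by simp_all
    ultimately show "four_block_mat (A * 1\<^sub>m n + 0\<^sub>m n 1 * 0\<^sub>m 1 n) (A * (- c) + 0\<^sub>m n 1 * ?t)
        (- w\<^sup>T * 1\<^sub>m n + 1\<^sub>m 1 * 0\<^sub>m 1 n) (- w\<^sup>T * (- c) + 1\<^sub>m 1 * ?t) = ?K"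
      by simp
  qed (use A c wc in auto)
  have KH: "?K * ?H = ?N"
  proof (subst mult_four_block_mat[of _ n n _ 1 _ 1 _ _ n _ 1])
    have "A * 1\<^sub>m n + - w * w\<^sup>T = ?M"
      by (rule eq_matI) (use A wc in \<open>auto simp: scalar_prod_def\<close>)
    moreover have "- w\<^sup>T * 1\<^sub>m n + ?s * w\<^sup>T = (s - 1) \<cdot>\<^sub>m w\<^sup>T"
      by (rule eq_matI) (use wc in \<open>auto simp: scalar_prod_def algebra_simps\<close>)
    moreover have "A * 0\<^sub>m n 1 + - w * 1\<^sub>m 1 = - w" "- w\<^sup>T * 0\<^sub>m n 1 + ?s * 1\<^sub>m 1 = ?s"
      using A wc by simp_all
    ultimately show "four_block_mat (A * 1\<^sub>m n + - w * w\<^sup>T) (A * 0\<^sub>m n 1 + - w * 1\<^sub>m 1)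
        (- w\<^sup>T * 1\<^sub>m n + ?s * w\<^sup>T) (- w\<^sup>T * 0\<^sub>m n 1 + ?s * 1\<^sub>m 1) = ?N"
      by simp
  qed (use A c wc in auto)
  have car: "?F \<in> carrier_mat (n + 1) (n + 1)" "?G \<in> carrier_mat (n + 1) (n + 1)"
    "?H \<in> carrier_mat (n + 1) (n + 1)" "?K \<in> carrier_mat (n + 1) (n + 1)"
    using A by (simp_all only: four_block_carrier_mat one_carrier_mat mat_carrier)
  have "det ?N = det ?F * det ?G * det ?H"
    using det_mult[OF car(1,2)] det_mult[OF car(4,3)] FG KH by simp
  also have "det ?F = det A"
    by (subst det_four_block_mat_upper_right_zero[of _ n _ 1]) (use A wc in auto)
  also have "det ?G = s - q"
    by (subst det_four_block_mat_lower_left_zero[of _ n _ 1]) (use c in \<open>auto simp: det_single\<close>)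
  also have "det ?H = 1"
    by (subst det_four_block_mat_upper_right_zero[of _ n _ 1]) (use wc in auto)
  finally show ?thesis by simp
qed

text \<open>
  Since \<open>w\<close> agrees with the diagonal of \<open>A\<close> modulo 2, both \<open>A - w w\<^sup>T\<close> and its border by \<open>- w\<close> and \<open>0\<close> are
  even; their determinants are \<open>1 - q\<close> and \<open>- q\<close>. One of the two sizes is even and the other odd.
\<close>
lemma characteristic_vector_norm_mod_4:
  fixes A c :: "int mat"
  assumes A: "A \<in> carrier_mat n n" and c: "c \<in> carrier_mat n 1"
    and sym: "\<And>i j. i < n \<Longrightarrow> j < n \<Longrightarrow> A $$ (i,j) = A $$ (j,i)"
    and det: "det A = 1" and w: "w = A * c"
    and char: "\<And>i. i < n \<Longrightarrow> even (A $$ (i,i) - w $$ (i,0))"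
    and q: "q = (\<Sum>i<n. w $$ (i,0) * c $$ (i,0))"
  shows "4 dvd q - int n"
proof -
  define M where "M = mat n n (\<lambda>(i,j). A $$ (i,j) - w $$ (i,0) * w $$ (j,0))"
  define N where "N = four_block_mat M (- w) (- w\<^sup>T) (mat 1 1 (\<lambda>_. 0))"
  have wc: "w \<in> carrier_mat n 1" using A c w by simp
  have M: "M \<in> carrier_mat n n" by (simp add: M_def)
  then have N: "N \<in> carrier_mat (n + 1) (n + 1)" unfolding N_def by (intro four_block_carrier_mat) auto
  have "(0::int) \<cdot>\<^sub>m w\<^sup>T = 0\<^sub>m 1 n"
    by (rule eq_matI) (use wc in auto)
  then have "det (four_block_mat M (- w) ((1 - 1) \<cdot>\<^sub>m w\<^sup>T) (mat 1 1 (\<lambda>_. 1))) = det M"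
    by (subst det_four_block_mat_lower_left_zero[of _ n _ 1]) (use wc M in \<open>auto simp: det_single\<close>)
  then have detM: "det M = 1 - q"
    using det_bordered[OF A c w q, of 1] det by (simp add: M_def)
  have "(0 - 1) \<cdot>\<^sub>m w\<^sup>T = - w\<^sup>T"
    by (rule eq_matI) (use wc in auto)
  then have detN: "det N = - q"
    using det_bordered[OF A c w q, of 0] det by (simp add: M_def N_def)
  have "even (M $$ (i,i))" if "i < n" for i
    using char[OF that] that by (simp add: M_def)
  then have resM: "(odd n \<longrightarrow> even (det M)) \<and> (even n \<longrightarrow> 4 dvd det M \<or> 4 dvd det M - (-1) ^ (n div 2))"
    by (intro even_symmetric_det[OF M]) (auto simp: M_def sym)
  have resN: "(odd (n + 1) \<longrightarrow> even (det N)) \<and>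
      (even (n + 1) \<longrightarrow> 4 dvd det N \<or> 4 dvd det N - (-1) ^ ((n + 1) div 2))"
  proof (rule even_symmetric_det[OF N])
    show "N $$ (i,j) = N $$ (j,i)" if "i < n + 1" "j < n + 1" for i j
      using that wc by (auto simp: N_def M_def sym)
    show "even (N $$ (i,i))" if "i < n + 1" for i
      using that wc char by (auto simp: N_def M_def)
  qed
  show ?thesis
  proof (cases "even n")
    case True
    then obtain k where k: "n = 2 * k" by blast
    \<comment> \<open>The odd size of \<open>N\<close> makes \<open>q\<close> even, so
      \<open>1 - q\<close> must be \<open>(-1) ^ k\<close> modulo 4, and \<open>1 - (-1) ^ k\<close>
      is \<open>2 * k\<close> modulo 4.\<close>
    have "even q" using resN detN True by simp
    then have "\<not> 4 dvd 1 - q" by presburger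
    then have "4 dvd 1 - q - (-1) ^ k" using resM detM k by simp
    then show ?thesis
      using k by (cases "even k") (simp, presburger)+
  next
    case False
    then obtain k where k: "n = 2 * k + 1" by (blast elim: oddE)
    \<comment> \<open>The roles swap: \<open>M\<close> has odd size, so \<open>q\<close> is odd and
      equals \<open>(-1) ^ k\<close> modulo 4, which is \<open>2 * k + 1\<close>.\<close>
    have "even (1 - q)" using resM detM False by simp
    then have "\<not> 4 dvd - q" by presburger
    then have "4 dvd - q - (-1) ^ (k + 1)" using resN detN k by simp
    then show ?thesis
      using k by (cases "even k") (simp, presburger)+
  qed
qed

section \<open>Isometries and exceptional vectors\<close>

text \<open>A generated group lies in a subgroup as soon as its generators do, so only reflections
  and the negation have to be checked to be isometries.\<close>

lemma isometries_subgroup: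
  "subgroup {g \<in> Bij L. \<forall>x\<in>L. \<forall>y\<in>L. g x \<bullet> g y = x \<bullet> y} (BijGroup L)"
    (is "subgroup ?I _")
proof (rule group.subgroupI[OF group_BijGroup])
  show "?I \<subseteq> carrier (BijGroup L)" by (auto simp: BijGroup_def)
  show "?I \<noteq> {}" using id_Bij[of L] by fastforce
next
  fix g assume g: "g \<in> ?I"
  then have b: "bij_betw g L L" by (simp add: Bij_def)
  have "inv_into L g x \<bullet> inv_into L g y = x \<bullet> y" if "x \<in> L" "y \<in> L" for x y
  proof -
    have "inv_into L g x \<in> L" "inv_into L g y \<in> L"
      using g that by (simp_all add: Bij_inv_into_mem)
    then have "g (inv_into L g x) \<bullet> g (inv_into L g y) = inv_into L g x \<bullet> inv_into L g y"
      using g by simp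
    then show ?thesis using that by (simp add: bij_betw_inv_into_right[OF b])
  qed
  then show "inv\<^bsub>BijGroup L\<^esub> g \<in> ?I"
    using g restrict_inv_into_Bij[of g L] by (simp add: inv_BijGroup)
next
  fix g h assume "g \<in> ?I" "h \<in> ?I"
  then show "g \<otimes>\<^bsub>BijGroup L\<^esub> h \<in> ?I"
    using Bij_imp_funcset[of h L] by (auto simp: BijGroup_def compose_Bij compose_eq Pi_iff)
qed

text \<open>Equality in \<open>stable\<close> makes each restriction a bijection of
  \<open>E\<close>; restricting keeps the maps extensional, as elements of \<open>BijGroup E\<close>
  must be.\<close>

lemma restricted_group_action:
  assumes G: "subgroup G (BijGroup L)" and E: "E \<subseteq> L"
    and stable: "\<And>g. g \<in> G \<Longrightarrow> g ` E = E"
  shows "group_action ((BijGroup L)\<lparr>carrier := G\<rparr>) E (\<lambda>g. restrict g E)"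
proof -
  have GB: "g \<in> Bij L" if "g \<in> G" for g
    using subgroup.subset[OF G] that by (auto simp: BijGroup_def)
  have R: "restrict g E \<in> Bij E" if "g \<in> G" for g
    using GB[OF that] stable[OF that] E
    by (auto simp: Bij_def bij_betw_def intro: inj_on_subset)
  have "restrict (compose L g h) E = compose E (restrict g E) (restrict h E)"
    if "g \<in> G" "h \<in> G" for g h
    using E stable[OF that(2)] by (auto simp: compose_def fun_eq_iff)
  then have "(\<lambda>g. restrict g E) \<in> hom ((BijGroup L)\<lparr>carrier := G\<rparr>) (BijGroup E)"
    using GB R by (auto simp: hom_def BijGroup_def)
  then show ?thesis
    by (intro group_action.intro group_hom.intro group_hom_axioms.intro
        group_BijGroup group.subgroup_imp_group[OF group_BijGroup G])
qed

section \<open>Closure properties of unimodular lattices and of their exceptional vectors\<close>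

text \<open>Lets reflected and halved vectors be recognised as lattice points from their inner
  products, without coordinates.\<close>

lemma unimodular_iff:
  assumes "unimodular L"
  shows "v \<in> L \<longleftrightarrow> v \<in> span L \<and> (\<forall>x\<in>L. v \<bullet> x \<in> \<int>)"
proof -
  have "v \<in> L \<longleftrightarrow> v \<in> dual_lattice L" using assms by (simp add: unimodular_def)
  then show ?thesis by (simp add: dual_lattice_def)
qed

lemma unimodular_inner_Ints:
  assumes "unimodular L" "x \<in> L" "y \<in> L"
  shows "x \<bullet> y \<in> \<int>"
proof -
  have "x \<in> dual_lattice L" using assms(1,2) unfolding unimodular_def by (rule ssubst)
  then show ?thesis using assms(3) by (simp add: dual_lattice_def)
qed

lemma unimodular_uminus:
  assumes "unimodular L" "x \<in> L"
  shows "- x \<in> L"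
proof -
  have "- x \<in> span L" using assms(2) by (simp add: span_neg span_base)
  moreover have "\<forall>y\<in>L. (- x) \<bullet> y \<in> \<int>" using unimodular_inner_Ints[OF assms] by simp
  ultimately show ?thesis using unimodular_iff[OF assms(1)] by blast
qed

lemma unimodular_reflection:
  assumes "unimodular L" "x \<in> L" "\<alpha> \<in> L"
  shows "x - (x \<bullet> \<alpha>) *\<^sub>R \<alpha> \<in> L"
proof -
  note Ints = unimodular_inner_Ints[OF assms(1)]
  have "x - (x \<bullet> \<alpha>) *\<^sub>R \<alpha> \<in> span L"
    using assms(2,3) by (simp add: span_diff span_scale span_base)
  moreover have "\<forall>y\<in>L. (x - (x \<bullet> \<alpha>) *\<^sub>R \<alpha>) \<bullet> y \<in> \<int>"
    using Ints assms(2,3) by (simp add: inner_diff_left)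
  ultimately show ?thesis using unimodular_iff[OF assms(1)] by blast
qed

text \<open>Both \<open>x \<bullet> \<xi>\<close> and \<open>x \<bullet> \<eta>\<close> are
  congruent to \<open>x \<bullet> x\<close> modulo 2, so they differ by an even integer and the
  halved vector lies in the dual.\<close>

lemma characteristic_half_difference:
  assumes U: "unimodular L" and "\<xi> \<in> characteristic_vectors L" "\<eta> \<in> characteristic_vectors L"
  shows "(1/2) *\<^sub>R (\<xi> - \<eta>) \<in> L"
proof -
  have L: "\<xi> \<in> L" "\<eta> \<in> L" using assms by (auto simp: characteristic_vectors_def)
  have "((1/2) *\<^sub>R (\<xi> - \<eta>)) \<bullet> x \<in> \<int>" if "x \<in> L" for x
  proof -
    have "[x \<bullet> \<xi> = x \<bullet> x] (rmod 2)" "[x \<bullet> \<eta> = x \<bullet> x] (rmod 2)"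
      using assms that by (auto simp: characteristic_vectors_def)
    then obtain k l where "x \<bullet> x = x \<bullet> \<xi> + of_int k * 2" "x \<bullet> x = x \<bullet> \<eta> + of_int l * 2"
      unfolding rcong_altdef by blast
    then have "((1/2) *\<^sub>R (\<xi> - \<eta>)) \<bullet> x = of_int (l - k)"
      by (simp add: inner_diff_left inner_commute[of x \<xi>] inner_commute[of x \<eta>])
    then show ?thesis by (metis Ints_of_int)
  qed
  moreover have "(1/2) *\<^sub>R (\<xi> - \<eta>) \<in> span L"
    using L by (simp add: span_diff span_scale span_base)
  ultimately show ?thesis using unimodular_iff[OF U] by blast
qed

text \<open>Inner products with \<open>\<xi>\<close> are integers on \<open>L\<close>, and an
  integer has the parity of its negative.\<close>

lemma Exc_uminus:
  assumes "unimodular L" "\<xi> \<in> Exc L"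
  shows "- \<xi> \<in> Exc L"
proof -
  have "[x \<bullet> (- \<xi>) = x \<bullet> x] (rmod 2)" if "x \<in> L" for x
  proof -
    have "x \<bullet> \<xi> \<in> \<int>" using assms that by (auto simp: Exc_def characteristic_vectors_def intro: unimodular_inner_Ints)
    then obtain k where k: "x \<bullet> \<xi> = of_int k" by (auto elim: Ints_cases)
    have "[x \<bullet> (- \<xi>) = x \<bullet> \<xi>] (rmod 2)"
      unfolding rcong_altdef by (rule exI[of _ k]) (simp add: k)
    then show ?thesis
      using assms that by (auto simp: Exc_def characteristic_vectors_def intro: rcong_trans)
  qed
  then show ?thesis
    using assms by (auto simp: Exc_def characteristic_vectors_def unimodular_uminus)
qed

text \<open>Being exceptional is expressed by inner products with all of \<open>L\<close>, and
  \<open>g\<close> permutes \<open>L\<close>.\<close>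

lemma isometry_image_Exc:
  assumes g: "g \<in> Bij L" and iso: "\<forall>x\<in>L. \<forall>y\<in>L. g x \<bullet> g y = x \<bullet> y"
  shows "g ` Exc L = Exc L"
proof -
  have im: "g ` L = L" using g by (simp add: Bij_def bij_betw_def)
  have "g \<xi> \<in> Exc L \<longleftrightarrow> \<xi> \<in> Exc L" if "\<xi> \<in> L" for \<xi>
  proof -
    have "(\<forall>x\<in>L. [x \<bullet> g \<xi> = x \<bullet> x] (rmod 2)) \<longleftrightarrow> (\<forall>x\<in>g ` L. [x \<bullet> g \<xi> = x \<bullet> x] (rmod 2))"
      by (simp only: im)
    also have "\<dots> \<longleftrightarrow> (\<forall>x\<in>L. [x \<bullet> \<xi> = x \<bullet> x] (rmod 2))"
      using iso that by simp
    finally show ?thesis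
      using iso that im by (auto simp: Exc_def characteristic_vectors_def)
  qed
  moreover have "Exc L \<subseteq> L" by (auto simp: Exc_def characteristic_vectors_def)
  ultimately have "g ` Exc L \<subseteq> Exc L" "\<And>y. y \<in> Exc L \<Longrightarrow> \<exists>x\<in>Exc L. y = g x"
    using im by (auto 0 3)
  then show ?thesis by (auto simp: image_iff)
qed

lemma uminus_isometry:
  assumes "unimodular L"
  shows "(\<lambda>x\<in>L. - x) \<in> {g \<in> Bij L. \<forall>x\<in>L. \<forall>y\<in>L. g x \<bullet> g y = x \<bullet> y}"
proof -
  have "bij_betw (\<lambda>x\<in>L. - x) L L"
    by (rule bij_betw_byWitness[where f' = uminus]) (auto simp: unimodular_uminus[OF assms])
  then show ?thesis by (simp add: Bij_def)
qed

lemma root_reflection_isometry: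
  assumes U: "unimodular L" and \<alpha>: "\<alpha> \<in> L" "\<alpha> \<bullet> \<alpha> = 2"
  shows "root_reflection L \<alpha> \<in> {g \<in> Bij L. \<forall>x\<in>L. \<forall>y\<in>L. g x \<bullet> g y = x \<bullet> y}"
proof -
  \<comment> \<open>Because \<open>\<alpha> \<bullet> \<alpha> = 2\<close>, the reflection is an
    involution and so its own inverse.\<close>
  have "bij_betw (root_reflection L \<alpha>) L L"
    by (rule bij_betw_byWitness[where f' = "root_reflection L \<alpha>"])
      (auto simp: root_reflection_def unimodular_reflection[OF U] \<alpha> inner_diff_left)
  then show ?thesis
    using \<alpha>(2) by (simp add: Bij_def root_reflection_def inner_diff_left inner_diff_right inner_commute)
qed

lemma weyl_group_pm_isometry:
  assumes U: "unimodular L"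
  shows "weyl_group_pm L \<subseteq> {g \<in> Bij L. \<forall>x\<in>L. \<forall>y\<in>L. g x \<bullet> g y = x \<bullet> y}"
proof -
  have "weyl_group L \<subseteq> {g \<in> Bij L. \<forall>x\<in>L. \<forall>y\<in>L. g x \<bullet> g y = x \<bullet> y}"
    unfolding weyl_group_def
    by (rule group.generate_subgroup_incl[OF group_BijGroup _ isometries_subgroup])
      (use root_reflection_isometry[OF U] in blast)
  then show ?thesis
    unfolding weyl_group_pm_def
    by (intro group.generate_subgroup_incl[OF group_BijGroup _ isometries_subgroup] insert_subsetI
        uminus_isometry[OF U])
qed

lemma weyl_group_pm_subgroup:
  assumes "unimodular L"
  shows "subgroup (weyl_group_pm L) (BijGroup L)"
proof -
  have "insert (\<lambda>x\<in>L. - x) (weyl_group L) \<subseteq> weyl_group_pm L"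
    unfolding weyl_group_pm_def by (intro subsetI generate.incl)
  then have "insert (\<lambda>x\<in>L. - x) (weyl_group L) \<subseteq> carrier (BijGroup L)"
    using weyl_group_pm_isometry[OF assms] unfolding BijGroup_def by fastforce
  then show ?thesis
    unfolding weyl_group_pm_def by (rule group.generate_is_subgroup[OF group_BijGroup])
qed

section \<open>Gram matrices of unimodular lattices\<close>

text \<open>Riesz representation: \<open>adjoint g 1\<close> represents a linear extension of
  \<open>f\<close>, and its projection to the span has the same inner products with
  \<open>B\<close>.\<close>

lemma ex_dual_vector:
  fixes B :: "'a::euclidean_space set"
  assumes "independent B"
  shows "\<exists>v\<in>span B. \<forall>x\<in>B. v \<bullet> x = f x"
proof -
  obtain g :: "'a \<Rightarrow> real" where g: "linear g" "\<forall>x\<in>B. g x = f x"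
    using linear_independent_extend[OF assms] by blast
  obtain v z where vz: "v \<in> span B" "\<And>w. w \<in> span B \<Longrightarrow> orthogonal z w" "adjoint g 1 = v + z"
    using orthogonal_subspace_decomp_exists[of B "adjoint g 1"] by metis
  have "v \<bullet> x = f x" if "x \<in> B" for x
  proof -
    have "z \<bullet> x = 0" using vz(2)[of x] that by (simp add: span_base Linear_Algebra.orthogonal_def)
    then have "v \<bullet> x = x \<bullet> adjoint g 1" by (simp add: vz(3) inner_add_right inner_commute)
    also have "\<dots> = g x" using adjoint_works[OF g(1), of x 1] by simp
    finally show ?thesis using g(2) that by simp
  qed
  then show ?thesis using vz(1) by blast
qed

lemma lattice_basis_subset:
  assumes "lattice_basis B L"
  shows "B \<subseteq> L"
proof
  fix x assume "x \<in> B"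
  then have "x = (\<Sum>b\<in>B. of_int (if b = x then 1 else 0) *\<^sub>R b)"
    using assms by (simp add: lattice_basis_def if_distrib[of "\<lambda>c. c *\<^sub>R _"] if_distrib[of real_of_int] cong: if_cong)
  then show "x \<in> L" using assms by (auto simp: lattice_basis_def)
qed

lemma lattice_basis_span:
  assumes "lattice_basis B L"
  shows "span L = span B"
proof
  have "(\<Sum>b\<in>B. of_int (c b) *\<^sub>R b) \<in> span B" for c :: "'a \<Rightarrow> int"
    by (rule span_sum) (simp add: span_scale span_base)
  then have "L \<subseteq> span B" using assms by (auto simp: lattice_basis_def)
  then show "span L \<subseteq> span B" by (simp add: span_minimal)
  show "span B \<subseteq> span L" using lattice_basis_subset[OF assms] by (rule span_mono)
qed

text \<open>The floor serves to give integer entries; it changes no value when the vectors lie in an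
  integral lattice.\<close>

definition gram_matrix :: "(nat \<Rightarrow> 'a::euclidean_space) \<Rightarrow> nat \<Rightarrow> int mat" where
  "gram_matrix b n = mat n n (\<lambda>(i,j). \<lfloor>b i \<bullet> b j\<rfloor>)"

lemma gram_matrix_index:
  assumes "\<And>x y. x \<in> L \<Longrightarrow> y \<in> L \<Longrightarrow> x \<bullet> y \<in> \<int>" "b ` {..<n} \<subseteq> L" "i < n" "j < n"
  shows "of_int (gram_matrix b n $$ (i,j)) = b i \<bullet> b j"
  using assms by (simp add: gram_matrix_def image_subset_iff)

text \<open>In an orthonormal basis of the span the Gram matrix becomes \<open>C\<^sup>T C\<close> with \<open>C\<close> square.\<close>
lemma gram_det_nonneg:
  assumes int: "\<And>x y. x \<in> L \<Longrightarrow> y \<in> L \<Longrightarrow> x \<bullet> y \<in> \<int>" and bL: "b ` {..<n} \<subseteq> L"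
    and dim: "dim (b ` {..<n}) = n"
  shows "0 \<le> det (gram_matrix b n)"
proof -
  obtain E where E: "pairwise orthogonal E" "\<And>x. x \<in> E \<Longrightarrow> norm x = 1"
    "independent E" "card E = n" "span E = span (b ` {..<n})"
    using orthonormal_basis_subspace[OF subspace_span[of "b ` {..<n}"]] dim by (metis dim_span)
  have fin: "finite E" using E(3) by (rule independent_imp_finite)
  obtain e where e: "bij_betw e {..<n} E"
    using ex_bij_betw_nat_finite[OF fin] E(4) by (auto simp: lessThan_atLeast0)
  define C where "C = mat n n (\<lambda>(i,j). e i \<bullet> b j)"
  have C: "C \<in> carrier_mat n n" by (simp add: C_def)
  have "map_mat real_of_int (gram_matrix b n) = C\<^sup>T * C"
  proof (rule eq_matI)
    fix i j assume "i < dim_row (C\<^sup>T * C)" "j < dim_col (C\<^sup>T * C)"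
    then have ij: "i < n" "j < n" by (simp_all add: C_def)
    have "b i \<in> span E" using E(5) ij by (simp add: span_base)
    then have "b i = (\<Sum>x\<in>E. (b i \<bullet> x) *\<^sub>R x)"
      using orthonormal_basis_expand[OF E(1,2) _ fin] by simp
    then have "b i \<bullet> b j = (\<Sum>x\<in>E. (b i \<bullet> x) *\<^sub>R x) \<bullet> b j"
      by (rule arg_cong)
    also have "\<dots> = (\<Sum>x\<in>E. (b i \<bullet> x) * (x \<bullet> b j))"
      by (simp add: inner_sum_left)
    also have "\<dots> = (\<Sum>k<n. (b i \<bullet> e k) * (e k \<bullet> b j))"
      by (rule sum.reindex_bij_betw[OF e, symmetric])
    also have "\<dots> = (C\<^sup>T * C) $$ (i,j)"
      using ij by (simp add: C_def scalar_prod_def lessThan_atLeast0 inner_commute)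
    finally show "map_mat real_of_int (gram_matrix b n) $$ (i,j) = (C\<^sup>T * C) $$ (i,j)"
      using ij gram_matrix_index[OF int bL ij] by (simp add: gram_matrix_def)
  qed (simp_all add: C_def gram_matrix_def)
  then have "real_of_int (det (gram_matrix b n)) = det (C\<^sup>T * C)"
    by (metis of_int_hom.hom_det)
  also have "\<dots> = det C * det C"
    using det_mult[of "C\<^sup>T" n C] det_transpose[OF C] C by simp
  finally have "0 \<le> real_of_int (det (gram_matrix b n))" by simp
  then show ?thesis by simp
qed

text \<open>Unimodularity puts the dual basis into \<open>L\<close>, so the inverse Gram matrix is integral.\<close>
lemma unimodular_gram_det:
  assumes basis: "lattice_basis B L" and b: "bij_betw b {..<n} B" and U: "unimodular L"
  shows "det (gram_matrix b n) = 1"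
proof -
  note int = unimodular_inner_Ints[OF U]
  have B: "finite B" "independent B" and L: "L = range (\<lambda>c :: 'a \<Rightarrow> int. \<Sum>b\<in>B. of_int (c b) *\<^sub>R b)"
    using basis by (auto simp: lattice_basis_def)
  have img: "b ` {..<n} = B" using b by (simp add: bij_betw_def)
  then have bL: "b ` {..<n} \<subseteq> L" using lattice_basis_subset[OF basis] by simp
  have bB: "b i \<in> B" if "i < n" for i using img that by blast
  \<comment> \<open>For \<open>x\<close> in \<open>B\<close>, \<open>d x\<close> holds the
    coordinates of the dual basis vector of \<open>x\<close>; they are integers because that vector
    lies in \<open>L\<close>.\<close>
  have "\<exists>d :: 'a \<Rightarrow> int. \<forall>y\<in>B. (\<Sum>z\<in>B. of_int (d z) * (z \<bullet> y)) = (if x = y then 1 else 0)" for x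
  proof -
    obtain v where v: "v \<in> span B" "\<forall>y\<in>B. v \<bullet> y = (if x = y then 1 else 0)"
      using ex_dual_vector[OF B(2), of "\<lambda>y. if x = y then 1 else 0"] by blast
    have "v \<bullet> y \<in> \<int>" if y: "y \<in> L" for y
    proof -
      obtain c :: "'a \<Rightarrow> int" where "y = (\<Sum>z\<in>B. of_int (c z) *\<^sub>R z)" using y L by auto
      then have "v \<bullet> y = (\<Sum>z\<in>B. of_int (c z) * (v \<bullet> z))" by (simp add: inner_sum_right)
      also have "\<dots> \<in> \<int>" using v(2) by (intro Ints_sum) auto
      finally show ?thesis .
    qed
    moreover have "v \<in> span L" using v(1) lattice_basis_span[OF basis] by simp
    ultimately have "v \<in> L" using unimodular_iff[OF U] by blast
    then obtain d :: "'a \<Rightarrow> int" where d: "v = (\<Sum>z\<in>B. of_int (d z) *\<^sub>R z)" using L by auto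
    have "(\<Sum>z\<in>B. of_int (d z) * (z \<bullet> y)) = v \<bullet> y" for y
      by (simp add: d inner_sum_left)
    then show ?thesis using v(2) by (intro exI[of _ d]) simp
  qed
  then obtain d :: "'a \<Rightarrow> 'a \<Rightarrow> int"
    where d: "\<And>x y. y \<in> B \<Longrightarrow> (\<Sum>z\<in>B. of_int (d x z) * (z \<bullet> y)) = (if x = y then 1 else 0)"
    by metis
  define D where "D = mat n n (\<lambda>(i,j). d (b i) (b j))"
  have "D * gram_matrix b n = 1\<^sub>m n"
  proof (rule eq_matI)
    fix i j assume "i < dim_row (1\<^sub>m n :: int mat)" "j < dim_col (1\<^sub>m n :: int mat)"
    then have ij: "i < n" "j < n" by simp_all
    have "real_of_int ((D * gram_matrix b n) $$ (i,j))
        = (\<Sum>k<n. of_int (d (b i) (b k)) * of_int (gram_matrix b n $$ (k,j)))"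
      using ij by (simp add: D_def gram_matrix_def scalar_prod_def lessThan_atLeast0)
    also have "\<dots> = (\<Sum>k<n. of_int (d (b i) (b k)) * (b k \<bullet> b j))"
      using gram_matrix_index[OF int bL _ ij(2)] by simp
    also have "\<dots> = (\<Sum>z\<in>B. of_int (d (b i) z) * (z \<bullet> b j))"
      by (rule sum.reindex_bij_betw[OF b])
    also have "\<dots> = (if b i = b j then 1 else 0)" using d bB ij by simp
    also have "\<dots> = real_of_int (1\<^sub>m n $$ (i,j))"
      using ij b by (auto simp: bij_betw_def inj_on_def)
    finally show "(D * gram_matrix b n) $$ (i,j) = 1\<^sub>m n $$ (i,j)" by (simp only: of_int_eq_iff)
  qed (simp_all add: D_def gram_matrix_def)
  then have "det D * det (gram_matrix b n) = 1"
    using det_mult[of D n "gram_matrix b n"] by (simp add: D_def gram_matrix_def)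
  moreover have "dim (b ` {..<n}) = n"
    using img dim_eq_card_independent[OF B(2)] bij_betw_same_card[OF b] by simp
  \<comment> \<open>Integers with product 1 are both 1 or both -1, and a Gram determinant is not
    negative.\<close>
  ultimately show ?thesis
    using gram_det_nonneg[OF int bL] by (auto simp: zmult_eq_1_iff mult.commute)
qed

text \<open>With \<open>C\<close> the coordinates of \<open>\<xi>\<close>, \<open>w\<close> lists
  its inner products with the basis and \<open>q\<close> is its norm; the characteristic condition
  on basis vectors is the parity condition on the diagonal.\<close>

lemma unimodular_characteristic_norm_mod_4:
  assumes lattice: "integral_lattice_of_rank n L" and U: "unimodular L"
    and \<xi>: "\<xi> \<in> characteristic_vectors L"
  shows "[\<xi> \<bullet> \<xi> = real n] (rmod 4)"
proof -
  note int = unimodular_inner_Ints[OF U]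
  obtain B where basis: "lattice_basis B L" and card: "card B = n"
    using lattice by (auto simp: integral_lattice_of_rank_def)
  then have "finite B" by (simp add: lattice_basis_def)
  then obtain b where b: "bij_betw b {..<n} B"
    using ex_bij_betw_nat_finite card by (metis lessThan_atLeast0)
  then have bL: "b ` {..<n} \<subseteq> L"
    using lattice_basis_subset[OF basis] by (simp add: bij_betw_def)
  have \<xi>L: "\<xi> \<in> L" using \<xi> by (simp add: characteristic_vectors_def)
  then obtain c :: "'a \<Rightarrow> int" where c: "\<xi> = (\<Sum>x\<in>B. of_int (c x) *\<^sub>R x)"
    using basis by (auto simp: lattice_basis_def)
  have \<xi>_eq: "\<xi> = (\<Sum>i<n. of_int (c (b i)) *\<^sub>R b i)"
    unfolding c by (rule sum.reindex_bij_betw[OF b, symmetric])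
  define A where "A = gram_matrix b n"
  define C where "C = mat n 1 (\<lambda>(i,_). c (b i))"
  define w where "w = A * C"
  define q where "q = (\<Sum>i<n. w $$ (i,0) * C $$ (i,0))"
  have A: "A \<in> carrier_mat n n" by (simp add: A_def gram_matrix_def)
  have w: "real_of_int (w $$ (i,0)) = b i \<bullet> \<xi>" if "i < n" for i
  proof -
    have "real_of_int (w $$ (i,0)) = (\<Sum>k<n. of_int (A $$ (i,k)) * of_int (c (b k)))"
      using that A by (simp add: w_def C_def scalar_prod_def lessThan_atLeast0)
    also have "\<dots> = (\<Sum>k<n. (b i \<bullet> b k) * of_int (c (b k)))"
      using gram_matrix_index[OF int bL that] by (simp add: A_def)
    also have "\<dots> = b i \<bullet> \<xi>"
      by (subst \<xi>_eq) (simp add: inner_sum_right mult.commute)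
    finally show ?thesis .
  qed
  have "4 dvd q - int n"
  proof (rule characteristic_vector_norm_mod_4[OF A _ _ _ w_def _ q_def])
    show "C \<in> carrier_mat n 1" by (simp add: C_def)
    show "A $$ (i,j) = A $$ (j,i)" if "i < n" "j < n" for i j
      using that by (simp add: A_def gram_matrix_def inner_commute)
    show "det A = 1" unfolding A_def by (rule unimodular_gram_det[OF basis b U])
    show "even (A $$ (i,i) - w $$ (i,0))" if "i < n" for i
    proof -
      have "b i \<in> L" using bL that by auto
      then obtain k where "b i \<bullet> b i = b i \<bullet> \<xi> + of_int k * 2"
        using \<xi> by (auto simp: characteristic_vectors_def rcong_altdef)
      then have "real_of_int (A $$ (i,i)) = real_of_int (w $$ (i,0) + k * 2)"
        using gram_matrix_index[OF int bL that that] w[OF that] by (simp add: A_def)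
      then have "A $$ (i,i) - w $$ (i,0) = k * 2" by linarith
      then show ?thesis by simp
    qed
  qed
  then obtain k where k: "q = int n + 4 * k" by (metis dvdE diff_eq_eq add.commute)
  have "real_of_int q = (\<Sum>i<n. (b i \<bullet> \<xi>) * of_int (c (b i)))"
    by (simp add: q_def w C_def)
  also have "\<dots> = \<xi> \<bullet> \<xi>"
    by (subst (2) \<xi>_eq) (simp add: inner_sum_left mult.commute)
  finally have "\<xi> \<bullet> \<xi> = real n + of_int k * 4" by (simp add: k)
  then show ?thesis by (metis rcong_altdef rcong_sym)
qed

section \<open>Exceptional vectors of norm 5\<close>

text \<open>The norm is a nonnegative integer below 8 and congruent to 1 modulo 4, which leaves 1
  and 5.\<close>

lemma Exc_norm:
  assumes lattice: "integral_lattice_of_rank n L" and U: "unimodular L" and n: "n mod 8 = 5"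
    and no1: "\<not> (\<exists>x\<in>L. x \<bullet> x = 1)" and \<xi>: "\<xi> \<in> Exc L"
  shows "\<xi> \<bullet> \<xi> = 5"
proof -
  have char: "\<xi> \<in> characteristic_vectors L" "\<xi> \<in> L" "\<xi> \<bullet> \<xi> < 8"
    using \<xi> by (auto simp: Exc_def characteristic_vectors_def)
  then obtain k where k: "real n = \<xi> \<bullet> \<xi> + of_int k * 4"
    using unimodular_characteristic_norm_mod_4[OF lattice U] by (auto simp: rcong_altdef)
  then have eq: "\<xi> \<bullet> \<xi> = of_int (int n - 4 * k)" by simp
  then have "0 \<le> int n - 4 * k" "int n - 4 * k < 8" "int n - 4 * k \<noteq> 1"
    using char no1 inner_ge_zero[of \<xi>] by (auto simp del: of_int_diff inner_ge_zero)
  moreover have "int n mod 8 = 5" using n by presburger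
  ultimately have "int n - 4 * k = 5" by presburger
  then show ?thesis using eq by simp
qed

text \<open>On a finite subset the Gram matrix is the all-ones matrix plus \<open>r\<close> times
  the identity, which is positive definite.\<close>

lemma independent_constant_inner:
  fixes S :: "'a::euclidean_space set"
  assumes r: "r > 0" and inner: "\<And>x y. x \<in> S \<Longrightarrow> y \<in> S \<Longrightarrow> x \<bullet> y = (if x = y then 1 + r else 1)"
  shows "independent S"
  unfolding independent_explicit_finite_subsets
proof (intro allI impI ballI)
  fix T u v
  assume T: "T \<subseteq> S" "finite T" and zero: "(\<Sum>v\<in>T. u v *\<^sub>R v) = 0" and v: "v \<in> T"
  define s where "s = sum u T"
  have u: "r * u t = - s" if "t \<in> T" for t
  proof -
    have "v \<bullet> t = (if v = t then 1 + r else 1)" if "v \<in> T" for v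
      using T(1) that \<open>t \<in> T\<close> by (intro inner) auto
    then have *: "u v * (v \<bullet> t) = u v + (if v = t then r * u v else 0)" if "v \<in> T" for v
      using that by (simp add: algebra_simps)
    have "0 = (\<Sum>v\<in>T. u v *\<^sub>R v) \<bullet> t" using zero by simp
    also have "\<dots> = (\<Sum>v\<in>T. u v + (if v = t then r * u v else 0))"
      using * by (simp add: inner_sum_left)
    also have "\<dots> = s + r * u t" using T that by (simp add: sum.distrib s_def)
    finally show ?thesis by simp
  qed
  \<comment> \<open>Summing over \<open>T\<close> the relations obtained by pairing with each
    \<open>t\<close> makes the coefficient sum vanish, and then each coefficient.\<close>
  have "r * s = (\<Sum>t\<in>T. r * u t)" by (simp add: s_def sum_distrib_left)
  also have "\<dots> = - real (card T) * s" using u by simp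
  finally have "(r + real (card T)) * s = 0" by (simp add: algebra_simps)
  moreover have "r + real (card T) > 0" using r by simp
  ultimately have "s = 0" by simp
  then show "u v = 0" using u[OF v] r by simp
qed

text \<open>From here on the condition on the rank modulo 8 enters only through
  \<open>norm_5\<close>.\<close>

locale exceptional_lattice =
  fixes L :: "'a::euclidean_space set"
  assumes unimodular: "unimodular L"
    and no_norm_1: "\<And>x. x \<in> L \<Longrightarrow> x \<bullet> x \<noteq> 1"
    and norm_5: "\<And>\<xi>. \<xi> \<in> Exc L \<Longrightarrow> \<xi> \<bullet> \<xi> = 5"
begin

lemma half_difference:
  assumes "\<xi> \<in> Exc L" "\<eta> \<in> Exc L"
  shows "(1/2) *\<^sub>R (\<xi> - \<eta>) \<in> L"
  using assms by (intro characteristic_half_difference[OF unimodular]) (auto simp: Exc_def)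

lemma half_difference_norm:
  assumes "\<xi> \<in> Exc L" "\<eta> \<in> Exc L"
  shows "((1/2) *\<^sub>R (\<xi> - \<eta>)) \<bullet> ((1/2) *\<^sub>R (\<xi> - \<eta>)) = (5 - \<xi> \<bullet> \<eta>) / 2"
  using norm_5[OF assms(1)] norm_5[OF assms(2)]
  by (simp add: inner_diff_left inner_diff_right inner_commute[of \<eta> \<xi>] field_simps)

lemma Exc_inner_cases:
  assumes \<xi>: "\<xi> \<in> Exc L" and \<eta>: "\<eta> \<in> Exc L"
  obtains "\<eta> = \<xi>" | "\<eta> = - \<xi>" | "\<xi> \<bullet> \<eta> = 1" | "\<xi> \<bullet> \<eta> = - 1"
proof -
  note \<eta>' = Exc_uminus[OF unimodular \<eta>]
  have "(5 - \<xi> \<bullet> \<eta>) / 2 \<in> \<int>"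
    using unimodular_inner_Ints[OF unimodular half_difference half_difference] half_difference_norm \<xi> \<eta>
    by metis
  \<comment> \<open>\<open>k\<close> is the norm of half of \<open>\<xi> - \<eta>\<close>, and
    \<open>5 - k\<close> that of half of \<open>\<xi> + \<eta>\<close>; both are nonnegative
    integers other than 1.\<close>
  then obtain k where k: "(5 - \<xi> \<bullet> \<eta>) / 2 = of_int k" by (auto elim: Ints_cases)
  then have inner: "\<xi> \<bullet> \<eta> = of_int (5 - 2 * k)" by simp
  have k': "(5 - \<xi> \<bullet> (- \<eta>)) / 2 = of_int (5 - k)" using inner by simp
  have "of_int k \<noteq> (1::real)" "of_int k \<ge> (0::real)"
    using no_norm_1[OF half_difference[OF \<xi> \<eta>]] half_difference_norm[OF \<xi> \<eta>] k
      inner_ge_zero[of "(1/2) *\<^sub>R (\<xi> - \<eta>)"] by metis+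
  moreover have "of_int (5 - k) \<noteq> (1::real)" "of_int (5 - k) \<ge> (0::real)"
    using no_norm_1[OF half_difference[OF \<xi> \<eta>']] half_difference_norm[OF \<xi> \<eta>'] k'
      inner_ge_zero[of "(1/2) *\<^sub>R (\<xi> - (- \<eta>))"] by metis+
  ultimately have "k = 0 \<or> k = 2 \<or> k = 3 \<or> k = 5"
    by (simp only: of_int_eq_1_iff of_int_0_le_iff) presburger
  moreover have "\<eta> = \<xi>" if "k = 0"
    using half_difference_norm[OF \<xi> \<eta>] k that by simp
  moreover have "\<eta> = - \<xi>" if "k = 5"
  proof -
    have "(1/2) *\<^sub>R (\<xi> - (- \<eta>)) = 0"
      using half_difference_norm[OF \<xi> \<eta>'] k' that by (simp only: inner_eq_zero_iff) simp
    then show ?thesis by (simp add: eq_neg_iff_add_eq_0 add.commute)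
  qed
  ultimately show ?thesis using inner that by auto
qed

lemma Exc_positive_inner:
  assumes \<xi>: "\<xi> \<in> Exc L" and \<eta>: "\<eta> \<in> Exc L" "\<xi> \<bullet> \<eta> > 0" and \<zeta>: "\<zeta> \<in> Exc L" "\<xi> \<bullet> \<zeta> > 0"
    and neq: "\<eta> \<noteq> \<zeta>"
  shows "\<eta> \<bullet> \<zeta> = 1"
proof -
  have pos: "\<theta> = \<xi> \<or> \<xi> \<bullet> \<theta> = 1" if "\<theta> \<in> Exc L" "\<xi> \<bullet> \<theta> > 0" for \<theta>
    using Exc_inner_cases[OF \<xi> that(1)] that norm_5[OF \<xi>] by (cases, auto)
  consider "\<eta> = \<xi>" | "\<zeta> = \<xi>" | "\<xi> \<bullet> \<eta> = 1" "\<xi> \<bullet> \<zeta> = 1"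
    using pos[OF \<eta>] pos[OF \<zeta>] by blast
  then show ?thesis
  proof cases
    case 1
    then show ?thesis using pos[OF \<zeta>] neq by simp
  next
    case 2
    then show ?thesis using pos[OF \<eta>] neq by (simp add: inner_commute)
  next
    case 3
    have "((1/2) *\<^sub>R (\<xi> - \<eta>)) \<bullet> ((1/2) *\<^sub>R (\<xi> - \<zeta>)) \<in> \<int>"
      by (intro unimodular_inner_Ints[OF unimodular] half_difference \<xi> \<eta>(1) \<zeta>(1))
    moreover have "((1/2) *\<^sub>R (\<xi> - \<eta>)) \<bullet> ((1/2) *\<^sub>R (\<xi> - \<zeta>)) = (3 + \<eta> \<bullet> \<zeta>) / 4"
      using 3 norm_5[OF \<xi>] by (simp add: inner_diff_left inner_diff_right inner_commute[of \<eta> \<xi>] field_simps)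
    ultimately obtain k where "(3 + \<eta> \<bullet> \<zeta>) / 4 = of_int k" by (auto elim: Ints_cases)
    then have k: "\<eta> \<bullet> \<zeta> = of_int (4 * k - 3)" by simp
    from \<eta>(1) \<zeta>(1) show ?thesis
    proof (cases rule: Exc_inner_cases)
      case 1
      then show ?thesis using neq by simp
    next
      case 2
      \<comment> \<open>Opposite vectors cannot both have positive inner product with
        \<open>\<xi>\<close>.\<close>
      then show ?thesis using \<eta>(2) \<zeta>(2) by simp
    next
      case 3
      then show ?thesis .
    next
      case 4
      \<comment> \<open>An inner product of -1 would make the two roots pair to 1/2.\<close>
      then have "4 * k - 3 = - 1" using k by linarith
      then have False by presburger
      then show ?thesis ..
    qed
  qed
qed

text \<open>No exceptional vector is orthogonal to \<open>\<xi>\<close>, so \<open>S\<close>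
  contains exactly one of each pair \<open>\<eta>\<close>, \<open>- \<eta>\<close>. As
  \<open>S\<close> is independent and contains \<open>\<xi>\<close>, its size is the required
  \<open>m\<close>.\<close>

lemma Exc_card:
  assumes basis: "finite B" "L \<subseteq> span B" and \<xi>: "\<xi> \<in> Exc L"
  shows "\<exists>m. 1 \<le> m \<and> m \<le> card B \<and> finite (Exc L) \<and> card (Exc L) = 2 * m"
proof -
  define S where "S = {\<eta> \<in> Exc L. \<xi> \<bullet> \<eta> > 0}"
  have "\<eta> \<bullet> \<zeta> = (if \<eta> = \<zeta> then 1 + 4 else 1)" if "\<eta> \<in> S" "\<zeta> \<in> S" for \<eta> \<zeta>
    using that Exc_positive_inner[OF \<xi>] norm_5 by (auto simp: S_def)
  then have "independent S" by (intro independent_constant_inner[of 4]) auto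
  moreover have "S \<subseteq> span B"
    using basis(2) by (auto simp: S_def Exc_def characteristic_vectors_def)
  ultimately have S: "finite S" "card S \<le> card B"
    using independent_span_bound[OF basis(1)] by blast+
  have "\<xi> \<in> S" using \<xi> norm_5[OF \<xi>] by (simp add: S_def)
  then have "0 < card S" using S(1) by (auto simp: card_gt_0_iff)
  then have "1 \<le> card S" by simp
  moreover have Exc: "Exc L = S \<union> uminus ` S"
  proof
    show "Exc L \<subseteq> S \<union> uminus ` S"
    proof
      fix \<eta> assume \<eta>: "\<eta> \<in> Exc L"
      have "- \<eta> \<in> Exc L" by (rule Exc_uminus[OF unimodular \<eta>])
      moreover have "\<xi> \<bullet> \<eta> > 0 \<or> \<xi> \<bullet> (- \<eta>) > 0"
        using Exc_inner_cases[OF \<xi> \<eta>] norm_5[OF \<xi>] by (cases, auto)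
      ultimately have "\<eta> \<in> S \<or> - \<eta> \<in> S" using \<eta> by (auto simp: S_def)
      then show "\<eta> \<in> S \<union> uminus ` S" by (metis UnCI imageI minus_minus)
    qed
    show "S \<union> uminus ` S \<subseteq> Exc L" using Exc_uminus[OF unimodular] by (auto simp: S_def)
  qed
  moreover have "card (S \<union> uminus ` S) = 2 * card S"
    using S(1) by (subst card_Un_disjoint) (auto simp: S_def card_image)
  ultimately show ?thesis using S by auto
qed

lemma Exc_transitive:
  assumes x: "x \<in> Exc L" and y: "y \<in> Exc L"
  shows "\<exists>g\<in>weyl_group_pm L. g x = y"
proof -
  interpret W: subgroup "weyl_group_pm L" "BijGroup L"
    by (rule weyl_group_pm_subgroup[OF unimodular])
  have ExcL: "\<xi> \<in> L" if "\<xi> \<in> Exc L" for \<xi>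
    using that by (simp add: Exc_def characteristic_vectors_def)
  have one: "(\<lambda>x\<in>L. x) \<in> weyl_group_pm L"
    using W.one_closed by (simp add: BijGroup_def)
  have neg: "(\<lambda>x\<in>L. - x) \<in> weyl_group_pm L"
    unfolding weyl_group_pm_def by (intro generate.incl insertI1)
  have refl: "root_reflection L \<alpha> \<in> weyl_group_pm L" if "\<alpha> \<in> L" "\<alpha> \<bullet> \<alpha> = 2" for \<alpha>
    unfolding weyl_group_pm_def weyl_group_def
    by (intro generate.incl insertI2) (use that in blast)
  have pos: "\<exists>g\<in>weyl_group_pm L. g x = y" if y: "y \<in> Exc L" and "x \<bullet> y = 1" for y
  proof -
    define \<alpha> where "\<alpha> = (1/2) *\<^sub>R (x - y)"
    have "\<alpha> \<in> L" unfolding \<alpha>_def by (rule half_difference[OF x y])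
    moreover have "\<alpha> \<bullet> \<alpha> = 2"
      unfolding \<alpha>_def half_difference_norm[OF x y] using that by simp
    \<comment> \<open>Here \<open>x \<bullet> \<alpha>\<close> is (5 - 1)/2 = 2, so the reflection
      subtracts \<open>x - y\<close>.\<close>
    moreover have "root_reflection L \<alpha> x = y"
      using ExcL[OF x] norm_5[OF x] that
      by (simp add: root_reflection_def \<alpha>_def inner_diff_right)
    ultimately show ?thesis using refl by blast
  qed
  \<comment> \<open>For inner product -1 a reflection reaches \<open>- y\<close>, and the negation
    then leads to \<open>y\<close>.\<close>
  have compose_neg: "\<exists>g\<in>weyl_group_pm L. g x = y" if "\<exists>g\<in>weyl_group_pm L. g x = - y" for y
  proof -
    from that obtain g where g: "g \<in> weyl_group_pm L" "g x = - y" by (rule bexE)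
    have "weyl_group_pm L \<subseteq> Bij L" using W.subset by (simp add: BijGroup_def)
    note B = subsetD[OF this g(1)] subsetD[OF this neg]
    have "compose L (\<lambda>x\<in>L. - x) g \<in> weyl_group_pm L"
      using W.m_closed[OF neg g(1)] B by (simp add: BijGroup_def)
    then show ?thesis
    proof (rule bexI[rotated])
      show "compose L (\<lambda>x\<in>L. - x) g x = y"
        using ExcL[OF x] g(2) funcset_mem[OF Bij_imp_funcset[OF B(1)] ExcL[OF x]]
        by (simp add: compose_def)
    qed
  qed
  from x y show ?thesis
  proof (cases rule: Exc_inner_cases)
    case 1
    then show ?thesis using ExcL[OF x] by (intro bexI[OF _ one]) simp
  next
    case 2
    then show ?thesis using ExcL[OF x] by (intro bexI[OF _ neg]) simp
  next
    case 3
    then show ?thesis by (rule pos[OF y])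
  next
    case 4
    then have "x \<bullet> (- y) = 1" by simp
    then show ?thesis by (rule compose_neg[OF pos[OF Exc_uminus[OF unimodular y]]])
  qed
qed

end

theorem theorem6p5:
  fixes L :: "'a::euclidean_space set" and n :: nat
  assumes "integral_lattice_of_rank n L"
    and "odd_lattice L"
    and "unimodular L"
    and "n mod 8 = 5"
    and "\<not> (\<exists>x\<in>L. x \<bullet> x = 1)"
    and "Exc L \<noteq> {}"
  shows "(\<exists>m::nat. 1 \<le> m \<and> m \<le> n \<and> finite (Exc L) \<and> card (Exc L) = 2 * m) \<and>
    transitive_action ((BijGroup L)\<lparr>carrier := weyl_group_pm L\<rparr>) (Exc L)
      (\<lambda>g. restrict g (Exc L))"
proof
  interpret exceptional_lattice L
    using assms(3,5) Exc_norm[OF assms(1,3,4,5)] by unfold_locales auto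
  obtain B where basis: "lattice_basis B L" and card: "card B = n"
    using assms(1) by (auto simp: integral_lattice_of_rank_def)
  have "finite B" using basis by (simp add: lattice_basis_def)
  moreover have "L \<subseteq> span B"
    using lattice_basis_span[OF basis] span_superset by blast
  ultimately show "\<exists>m::nat. 1 \<le> m \<and> m \<le> n \<and> finite (Exc L) \<and> card (Exc L) = 2 * m"
    using Exc_card card assms(6) by blast
  have "Exc L \<subseteq> L" by (auto simp: Exc_def characteristic_vectors_def)
  moreover have "g ` Exc L = Exc L" if "g \<in> weyl_group_pm L" for g
    using weyl_group_pm_isometry[OF assms(3)] that by (intro isometry_image_Exc) blast+
  ultimately have "group_action ((BijGroup L)\<lparr>carrier := weyl_group_pm L\<rparr>) (Exc L)
      (\<lambda>g. restrict g (Exc L))"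
    by (rule restricted_group_action[OF weyl_group_pm_subgroup[OF assms(3)]])
  then show "transitive_action ((BijGroup L)\<lparr>carrier := weyl_group_pm L\<rparr>) (Exc L)
      (\<lambda>g. restrict g (Exc L))"
    using Exc_transitive by (intro transitive_action.intro transitive_action_axioms.intro) auto
qed

end
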